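(* Let $f\in\mathrm{Homeo}([0,1])$. Then the following six properties are equivalent: (1) $f$ is strongly singular, i.e. for almost every $x\in[0,1]$, $f$ is differentiable at $x$ and $f'(x)=0$; (2) $\lim_{r\downarrow0}\frac{\lambda(f(B(x,r)\cap[0,1]))}{\lambda(B(x,r))}=0$ for almost every $x\in[0,1]$; (3) $\lim_{r\downarrow0}\frac{\lambda(f^{-1}(B(y,r)))}{\lambda(B(y,r))}=0$ for almost every $y\in\mathbb{R}$; (4) the pushforward measure $\lambda\circ f^{-1}$ is singular with respect to $\lambda$; (5) $f$ is singular, i.e. there exists a Borel set $F\subseteq[0,1]$ such that $\lambda([0,1]\setminus F)=0$ and $\lambda(f(F))=0$; (6) the length of the graph of $f$ equals $2$.
   Context: $\mathrm{Homeo}([0,1])$ is the set of homeomorphisms of $[0,1]$ onto itself. $\lambda$ is Lebesgue measure on $\mathbb{R}$, $B(x,r)$ is the closed interval $[x-r,x+r]$, and $f^{-1}(A)=\{x\in[0,1]:f(x)\in A\}$; $\lambda\circ f^{-1}$ is the Borel measure $A\mapsto\lambda(f^{-1}(A))$ on $\mathbb{R}$. The length of the graph of $f$ is $\sup\sum_{i=1}^n|\gamma(x_i)-\gamma(x_{i-1})|$, where $\gamma(x)=(x,f(x))$, $|\cdot|$ is the Euclidean norm and the supremum is over all $n\ge1$ and $0=x_0<\dots<x_n=1$. *)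

theory Defs
  imports "HOL-Analysis.Analysis"
begin

text \<open>
  An element of Homeo([0,1]) is represented by a function \<open>f :: real \<Rightarrow> real\<close> of which only
  the restriction to \<open>{0..1}\<close> matters: no definition below depends on values of \<open>f\<close> elsewhere.

  Lebesgue measure is rendered by \<^const>\<open>lborel\<close>: all sets measured below are Borel
  (images of Borel sets under \<open>f\<close> included, as \<open>f\<close> is a homeomorphism), and
  \<^const>\<open>almost_everywhere\<close> asks only for containment in a null set, so "almost every" has the
  same meaning for \<^const>\<open>lborel\<close> as for its completion \<^term>\<open>lebesgue\<close>.
\<close>

definition Homeo01 :: "(real \<Rightarrow> real) set" where
  "Homeo01 = {f. \<exists>g. homeomorphism {0..1} {0..1} f g}"

definition preimage01 :: "(real \<Rightarrow> real) \<Rightarrow> real set \<Rightarrow> real set" where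
  "preimage01 f A = {x \<in> {0..1}. f x \<in> A}"

definition pushforward01 :: "(real \<Rightarrow> real) \<Rightarrow> real measure" where
  "pushforward01 f = distr (restrict_space lborel {0..1}) borel f"

lemma emeasure_pushforward01:
  assumes "f \<in> Homeo01" and "A \<in> sets borel"
  shows "emeasure (pushforward01 f) A = emeasure lborel (preimage01 f A)"
proof -
  have "continuous_on {0..1} f"
    using assms(1) by (auto simp: Homeo01_def homeomorphism_def)
  then have m: "f \<in> measurable (restrict_space lborel {0..1}) borel"
    using borel_measurable_continuous_on_restrict
    by (simp add: measurable_def sets_restrict_space space_restrict_space)
  have eq: "f -` A \<inter> space (restrict_space lborel {0..1}) = preimage01 f A"
    by (auto simp: preimage01_def space_restrict_space)
  have "emeasure (pushforward01 f) A
      = emeasure (restrict_space lborel {0..1}) (preimage01 f A)"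
    unfolding pushforward01_def using emeasure_distr[OF m assms(2)] eq by simp
  also have "\<dots> = emeasure lborel (preimage01 f A)"
    by (rule emeasure_restrict_space) (auto simp: preimage01_def)
  finally show ?thesis .
qed

definition mutually_singular :: "'a measure \<Rightarrow> 'a measure \<Rightarrow> bool" where
  "mutually_singular M N \<longleftrightarrow> sets M = sets N \<and>
     (\<exists>A \<in> sets M. emeasure M A = 0 \<and> emeasure N (space N - A) = 0)"

definition strongly_singular :: "(real \<Rightarrow> real) \<Rightarrow> bool" where
  "strongly_singular f \<longleftrightarrow>
     (AE x in lborel. x \<in> {0..1} \<longrightarrow> (f has_real_derivative 0) (at x within {0..1}))"

definition singular_fun :: "(real \<Rightarrow> real) \<Rightarrow> bool" where
  "singular_fun f \<longleftrightarrow>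
     (\<exists>F \<in> sets borel. F \<subseteq> {0..1} \<and> emeasure lborel ({0..1} - F) = 0 \<and> emeasure lborel (f ` F) = 0)"

text \<open>
  The norm on \<^typ>\<open>real \<times> real\<close> is the Euclidean one. The supremum is taken in
  \<^typ>\<open>ennreal\<close>, so that it exists unconditionally.
\<close>

definition graph_length :: "(real \<Rightarrow> real) \<Rightarrow> ennreal" where
  "graph_length f =
     (SUP (n, x) \<in> {(n :: nat, x :: nat \<Rightarrow> real).
          1 \<le> n \<and> x 0 = 0 \<and> x n = 1 \<and> (\<forall>i\<in>{1..n}. x (i - 1) < x i)}.
        ennreal (\<Sum>i = 1..n. norm ((x i, f (x i)) - (x (i - 1), f (x (i - 1))))))"

end

theory Submission
  imports Defs
begin

text \<open>
  A zero derivative on a set of full measure forces the image of that set to be null, by change of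
  variables. Conversely, if \<open>F\<close> has full measure and \<open>f ` F\<close> is null, enclose \<open>f ` F\<close> in a
  small open set \<open>U\<close>: around each point of \<open>F\<close> with a difference quotient at least \<open>k\<close> at
  arbitrarily small scales there are arbitrarily small balls \<open>B\<close> with \<open>f ` B \<subseteq> U\<close> of measure
  at least \<open>k\<close> times the radius, and Vitali's covering theorem bounds the measure of all such points.
  Being singular is symmetric in \<open>f\<close> and its inverse \<open>g\<close>, and condition (3) for \<open>f\<close> is
  condition (2) for \<open>g\<close>.

  For the length, a partition with horizontal steps \<open>a i\<close> and vertical steps \<open>b i\<close> has polygonal
  length at most \<open>\<Sum>i. a i + b i \<le> 2\<close>, with a defect of at least half of \<open>\<Sum>i. min (a i) (b i)\<close>.
  If the length is 2, the flat intervals (\<open>b i < a i\<close>) thus nearly fill \<open>[0,1]\<close> while their images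
  are nearly null, and Borel--Cantelli yields singularity. If \<open>f\<close> is singular, a fine uniform
  partition contributes almost 1 horizontally from the intervals meeting a large compact subset of
  \<open>F\<close> and almost 1 vertically from the others.
\<close>

section \<open>Homeomorphisms of the unit interval\<close>

text \<open>Images under \<open>f\<close> turn into preimages under the continuous inverse
  \<open>g\<close>. This is the source of Borel measurability for all images below.\<close>

lemma homeomorphism01_image_eq_preimage01:
  fixes f g :: "real \<Rightarrow> real"
  assumes "homeomorphism {0..1} {0..1} f g" "A \<subseteq> {0..1}"
  shows "f ` A = preimage01 g A"
proof (intro equalityI subsetI)
  show "y \<in> preimage01 g A" if "y \<in> f ` A" for y
  proof -
    obtain x where x: "x \<in> A" "y = f x" using \<open>y \<in> f ` A\<close> by blast
    have "f x \<in> f ` {0..1}" using x assms(2) by blast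
    then show ?thesis
      using assms x by (auto simp: preimage01_def homeomorphism_def simp del: atLeastAtMost_iff)
  qed
  show "y \<in> f ` A" if "y \<in> preimage01 g A" for y
    using assms(1) that by (intro image_eqI[of _ _ "g y"]) (auto simp: preimage01_def homeomorphism_def)
qed

lemma preimage01_borel:
  fixes f :: "real \<Rightarrow> real"
  assumes "continuous_on {0..1} f" "A \<in> sets borel"
  shows "preimage01 f A \<in> sets borel"
proof -
  have "f \<in> borel_measurable (restrict_space borel {0..1})"
    using assms(1) by (rule borel_measurable_continuous_on_restrict)
  from measurable_sets[OF this assms(2)]
  have "f -` A \<inter> {0..1} \<in> sets (restrict_space borel {0..1})"
    by (simp add: space_restrict_space)
  moreover have "f -` A \<inter> {0..1} = preimage01 f A"
    by (auto simp: preimage01_def)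
  ultimately show ?thesis
    by (auto simp: sets_restrict_space)
qed

lemma homeomorphism01_image_borel:
  fixes f g :: "real \<Rightarrow> real"
  assumes "homeomorphism {0..1} {0..1} f g" "A \<in> sets borel" "A \<subseteq> {0..1}"
  shows "f ` A \<in> sets borel"
  using preimage01_borel[of g A] homeomorphism01_image_eq_preimage01[of f g A] assms
  by (auto simp: homeomorphism_def)

lemma homeomorphism01_inj_on: "homeomorphism {0..1} {0..1} f g \<Longrightarrow> inj_on f {0..1}"
  by (metis homeomorphism_def inj_on_inverseI)

text \<open>Phrased with \<open>closed_segment\<close>, which is blind to the order of its
  endpoints, so that increasing and decreasing \<open>f\<close> are treated alike.\<close>

lemma homeomorphism01_image_segment:
  fixes f g :: "real \<Rightarrow> real"
  assumes "homeomorphism {0..1} {0..1} f g" "x \<in> {0..1}" "y \<in> {0..1}"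
  shows "f ` closed_segment x y = closed_segment (f x) (f y)"
proof (rule continuous_injective_image_segment_1)
  have sub: "closed_segment x y \<subseteq> {0..1}"
    using assms by (auto simp: closed_segment_eq_real_ivl)
  show "continuous_on (closed_segment x y) f"
    using assms(1) sub continuous_on_subset by (auto simp: homeomorphism_def)
  show "inj_on f (closed_segment x y)"
    using homeomorphism01_inj_on[OF assms(1)] sub inj_on_subset by blast
qed

lemma emeasure_lborel_closed_segment:
  "emeasure lborel (closed_segment a b) = ennreal \<bar>b - a\<bar>" for a b :: real
  by (auto simp: closed_segment_eq_real_ivl)

text \<open>Since \<open>measure\<close> sends infinite values to 0, finiteness is recorded before
  passing between \<open>measure\<close> and \<open>emeasure\<close>. The increment bound holds
  because the image of the ball contains the whole segment from \<open>f x\<close> to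
  \<open>f y\<close>.\<close>

lemma homeomorphism01_image_cball_bounds:
  fixes f g :: "real \<Rightarrow> real"
  assumes "homeomorphism {0..1} {0..1} f g" 
  shows "f ` (cball x r \<inter> {0..1}) \<in> sets borel"
    and "emeasure lborel (f ` (cball x r \<inter> {0..1})) = ennreal (measure lborel (f ` (cball x r \<inter> {0..1})))"
    and "\<lbrakk>x \<in> {0..1}; y \<in> {0..1}; \<bar>y - x\<bar> \<le> r\<rbrakk>
           \<Longrightarrow> \<bar>f y - f x\<bar> \<le> measure lborel (f ` (cball x r \<inter> {0..1}))"
proof -
  let ?A = "f ` (cball x r \<inter> {0..1})"
  show m: "?A \<in> sets borel"
    by (rule homeomorphism01_image_borel[OF assms]) (simp_all add: borel_closed closed_Int)
  have "?A \<subseteq> {0..1}"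
    using assms by (auto simp: homeomorphism_def)
  then have "emeasure lborel ?A \<le> emeasure lborel {0..1::real}"
    by (intro emeasure_mono) auto
  then have "emeasure lborel ?A < \<infinity>"
    by (simp add: le_less_trans)
  then show e: "emeasure lborel ?A = ennreal (measure lborel ?A)"
    by (simp add: emeasure_eq_ennreal_measure)
  assume xy: "x \<in> {0..1}" "y \<in> {0..1}" "\<bar>y - x\<bar> \<le> r"
  have "closed_segment x y \<subseteq> cball x r \<inter> {0..1}"
    using xy by (auto simp: closed_segment_eq_real_ivl dist_real_def split: if_splits)
  then have "closed_segment (f x) (f y) \<subseteq> ?A"
    using homeomorphism01_image_segment[OF assms xy(1,2)] by blast
  then have "emeasure lborel (closed_segment (f x) (f y)) \<le> emeasure lborel ?A"
    using m by (intro emeasure_mono) auto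
  then show "\<bar>f y - f x\<bar> \<le> measure lborel ?A"
    by (simp add: e emeasure_lborel_closed_segment)
qed

section \<open>Derivatives and densities\<close>

text \<open>Small difference quotients near \<open>x\<close> squeeze the image of a ball into a
  proportionally small ball around \<open>f x\<close>. Conversely, the image of the ball of radius
  \<open>\<bar>y - x\<bar>\<close> has measure at least the increment of \<open>f\<close> from
  \<open>x\<close> to \<open>y\<close>.\<close>

lemma has_real_derivative_0_iff_image_density:
  assumes hom: "homeomorphism {0..1} {0..1} f g" and x: "x \<in> {0..1}"
  shows "(f has_real_derivative 0) (at x within {0..1}) \<longleftrightarrow>
    ((\<lambda>r. measure lborel (f ` (cball x r \<inter> {0..1})) / measure lborel (cball x r)) \<longlongrightarrow> 0) (at_right 0)"
    (is "_ \<longleftrightarrow> (?q \<longlongrightarrow> 0) _")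
proof
  assume D: "(f has_real_derivative 0) (at x within {0..1})"
  show "(?q \<longlongrightarrow> 0) (at_right 0)"
  proof (rule tendstoI)
    fix e :: real assume "e > 0"
    from D have "((\<lambda>y. (f y - f x) / (y - x)) \<longlongrightarrow> 0) (at x within {0..1})"
      by (simp add: has_field_derivative_iff)
    then have "\<forall>\<^sub>F y in at x within {0..1}. dist ((f y - f x) / (y - x)) 0 < e/2"
      using \<open>e > 0\<close> by (intro tendstoD) auto
    then obtain d where d: "d > 0"
      "\<And>y. \<lbrakk>y \<in> {0..1}; y \<noteq> x; dist y x < d\<rbrakk> \<Longrightarrow> dist ((f y - f x) / (y - x)) 0 < e/2"
      unfolding eventually_at by auto
    have "?q r < e" if r: "0 < r" "r < d" for r
    proof -
      have "f ` (cball x r \<inter> {0..1}) \<subseteq> cball (f x) (e/2 * r)"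
      proof (rule image_subsetI)
        fix y assume y: "y \<in> cball x r \<inter> {0..1}"
        show "f y \<in> cball (f x) (e/2 * r)"
        proof (cases "y = x")
          case True
          then show ?thesis using \<open>e > 0\<close> r by simp
        next
          case False
          then have "\<bar>f y - f x\<bar> / \<bar>y - x\<bar> < e/2"
            using d(2)[of y] y r by (simp add: dist_commute)
          then have "\<bar>f y - f x\<bar> \<le> e/2 * \<bar>y - x\<bar>"
            using False by (simp add: field_simps)
          also have "\<dots> \<le> e/2 * r"
            using y \<open>e > 0\<close> by (intro mult_left_mono) (auto simp: dist_real_def)
          finally show ?thesis by (simp add: dist_real_def abs_minus_commute)
        qed
      qed
      then have "measure lborel (f ` (cball x r \<inter> {0..1})) \<le> measure lborel (cball (f x) (e/2 * r))"
        using homeomorphism01_image_cball_bounds(1)[OF hom]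
        by (intro measure_mono_fmeasurable) (auto intro: fmeasurable_compact)
      also have "\<dots> = e * r"
        using \<open>e > 0\<close> r by (simp add: cball_eq_atLeastAtMost)
      finally have "?q r \<le> e * r / (2 * r)"
        using r by (simp add: cball_eq_atLeastAtMost field_simps)
      also have "\<dots> < e" using r \<open>e > 0\<close> by simp
      finally show ?thesis .
    qed
    then show "\<forall>\<^sub>F r in at_right 0. dist (?q r) 0 < e"
      using d(1) by (auto simp: eventually_at_right intro!: exI[of _ d])
  qed
next
  assume L: "(?q \<longlongrightarrow> 0) (at_right 0)"
  have "((\<lambda>y. (f y - f x) / (y - x)) \<longlongrightarrow> 0) (at x within {0..1})"
  proof (rule tendstoI)
    fix e :: real assume "e > 0"
    \<comment> \<open>The ball has length \<open>2 * r\<close>, so \<open>e/2\<close> here gives the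
      factor \<open>e\<close> for the increment.\<close>
    then have "\<forall>\<^sub>F r in at_right 0. dist (?q r) 0 < e/2"
      using L by (intro tendstoD) auto
    then obtain d where d: "d > 0" "\<And>r. \<lbrakk>0 < r; r < d\<rbrakk> \<Longrightarrow> dist (?q r) 0 < e/2"
      unfolding eventually_at_right_field by auto
    have "dist ((f y - f x) / (y - x)) 0 < e" if y: "y \<in> {0..1}" "y \<noteq> x" "dist y x < d" for y
    proof -
      let ?r = "\<bar>y - x\<bar>"
      have "?q ?r < e/2"
        using d(2)[of ?r] y by (simp add: dist_real_def)
      then have "measure lborel (f ` (cball x ?r \<inter> {0..1})) < e * ?r"
        using y by (simp add: cball_eq_atLeastAtMost field_simps)
      with homeomorphism01_image_cball_bounds(3)[OF hom x y(1), of ?r]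
      have "\<bar>f y - f x\<bar> < e * ?r" by simp
      then show ?thesis using y by (simp add: field_simps)
    qed
    then show "\<forall>\<^sub>F y in at x within {0..1}. dist ((f y - f x) / (y - x)) 0 < e"
      unfolding eventually_at using d(1) by auto
  qed
  then show "(f has_real_derivative 0) (at x within {0..1})"
    by (simp add: has_field_derivative_iff)
qed

section \<open>Vanishing derivative almost everywhere versus singularity\<close>

text \<open>Change of variables with integrand 1: the measure of the image is the integral over
  \<open>S\<close> of the absolute derivative, that is, of 0.\<close>

lemma negligible_image_zero_derivative:
  fixes f :: "real \<Rightarrow> real"
  assumes "S \<in> sets lebesgue" "\<And>x. x \<in> S \<Longrightarrow> (f has_real_derivative 0) (at x within S)" "inj_on f S"
  shows "negligible (f ` S)"
proof -
  have "(\<lambda>x. 1::real) absolutely_integrable_on (f ` S) \<and> integral (f ` S) (\<lambda>x. 1::real) = 0"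
    using has_absolute_integral_change_of_variables_1'[OF assms, of "\<lambda>x. 1" 0] by simp
  then have "(\<lambda>x. 1::real) integrable_on (f ` S)" "integral (f ` S) (\<lambda>x. 1::real) = 0"
    using absolutely_integrable_on_def by blast+
  then show ?thesis
    by (simp add: negligible_iff_measure lmeasurable_iff_integrable_on lmeasure_integral)
qed

lemma singular_if_strongly_singular:
  assumes hom: "homeomorphism {0..1} {0..1} f g" and "strongly_singular f"
  shows "singular_fun f"
proof -
  obtain N where N: "N \<in> null_sets lborel"
    "{x. \<not> (x \<in> {0..1} \<longrightarrow> (f has_real_derivative 0) (at x within {0..1}))} \<subseteq> N"
    using assms(2) unfolding strongly_singular_def eventually_ae_filter by auto
  \<comment> \<open>Removing the Borel null set \<open>N\<close>, instead of the exceptional set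
    inside it, makes \<open>F\<close> Borel.\<close>
  define F where "F = {0..1} - N"
  have F: "F \<in> sets borel" "F \<subseteq> {0..1}"
    using N by (auto simp: F_def)
  have "negligible (f ` F)"
  proof (rule negligible_image_zero_derivative)
    show "F \<in> sets lebesgue" using F by simp
    show "inj_on f F"
      using homeomorphism01_inj_on[OF hom] F(2) inj_on_subset by blast
    show "(f has_real_derivative 0) (at x within F)" if "x \<in> F" for x
      by (rule has_field_derivative_subset[OF _ F(2)]) (use that N(2) in \<open>auto simp: F_def\<close>)
  qed
  then have "emeasure lebesgue (f ` F) = 0"
    by (auto simp: negligible_iff_null_sets)
  then have "emeasure lborel (f ` F) = 0"
    using homeomorphism01_image_borel[OF hom F] by simp
  moreover have "emeasure lborel ({0..1} - F) = 0"
  proof -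
    have "{0..1} - F = {0..1} \<inter> N" by (auto simp: F_def)
    moreover have "{0..1} \<inter> N \<in> null_sets lborel"
      using N(1) by (intro null_set_Int1) auto
    ultimately show ?thesis by auto
  qed
  ultimately show ?thesis
    unfolding singular_fun_def using F by blast
qed

text \<open>Vitali selects disjoint balls whose images lie in \<open>U\<close>, are disjoint by
  injectivity, and have measure at least \<open>k\<close> times the radius. Hence the total length
  of the balls is at most \<open>2 / k\<close> times the measure of \<open>U\<close>, which can be
  made arbitrarily small.\<close>

lemma negligible_large_derivates:
  fixes f g :: "real \<Rightarrow> real" and k :: real
  assumes hom: "homeomorphism {0..1} {0..1} f g" and F: "F \<in> sets borel" "F \<subseteq> {0..1}"
    and null: "emeasure lborel (f ` F) = 0" and "k > 0"
  shows "negligible {x \<in> F. \<forall>d>0. \<exists>y\<in>{0..1}. y \<noteq> x \<and> \<bar>y - x\<bar> < d \<and> k * \<bar>y - x\<bar> \<le> \<bar>f y - f x\<bar>}"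
    (is "negligible ?E")
proof (unfold negligible_outer_le, intro allI impI)
  fix e :: real assume "e > 0"
  have "f ` F \<in> sets lborel"
    using homeomorphism01_image_borel[OF hom F] by simp
  \<comment> \<open>The bound \<open>k * e / 2\<close> is chosen to cancel the factor
    \<open>2 / k\<close> and leave \<open>e\<close>.\<close>
  then obtain U where U: "open U" "f ` F \<subseteq> U" "emeasure lborel U < ennreal (k * e / 2)"
  proof -
    obtain U where "open U" "f ` F \<subseteq> U" "emeasure lborel (U - f ` F) < ennreal (k * e / 2)"
      using outer_regular_lborel[of "f ` F" "k * e / 2"] \<open>f ` F \<in> sets lborel\<close> \<open>k > 0\<close> \<open>e > 0\<close> by auto
    moreover have "emeasure lborel U = emeasure lborel (U - f ` F)"
      using null \<open>f ` F \<in> sets lborel\<close> \<open>open U\<close>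
      by (intro emeasure_Diff_null_set[symmetric]) auto
    ultimately show thesis using that by metis
  qed
  define B where "B = (\<lambda>(x, r). f ` (cball x r \<inter> {0..1}))"
  define K where "K = {(x, r). 0 < r \<and> B (x, r) \<subseteq> U \<and> ennreal (k * r) \<le> emeasure lborel (B (x, r))}"
  have Bm: "B i \<in> sets borel" for i
    using homeomorphism01_image_cball_bounds(1)[OF hom] by (cases i) (simp add: B_def)
  \<comment> \<open>The ball is centred at \<open>x\<close> and has on its boundary a point
    \<open>y\<close> with a large difference quotient. Continuity keeps its image in
    \<open>U\<close> once \<open>y\<close> is close enough.\<close>
  have cover: "\<exists>i. i \<in> K \<and> x \<in> cball (fst i) (snd i) \<and> snd i < d" if x: "x \<in> ?E" and "d > 0" for x d
  proof -
    have "x \<in> {0..1}" "f x \<in> U" using x F(2) U(2) by auto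
    moreover have "continuous_on {0..1} f" using hom by (simp add: homeomorphism_def)
    ultimately obtain \<delta> where \<delta>: "\<delta> > 0" "\<And>y. \<lbrakk>y \<in> {0..1}; dist y x < \<delta>\<rbrakk> \<Longrightarrow> f y \<in> U"
      using \<open>open U\<close> unfolding open_dist continuous_on_iff by metis
    obtain y where y: "y \<in> {0..1}" "y \<noteq> x" "\<bar>y - x\<bar> < min d \<delta>" "k * \<bar>y - x\<bar> \<le> \<bar>f y - f x\<bar>"
      using x \<open>d > 0\<close> \<delta>(1) by (smt (verit) mem_Collect_eq)
    have "B (x, \<bar>y - x\<bar>) \<subseteq> U"
      using \<delta>(2) y(3) by (auto simp: B_def dist_commute dist_real_def)
    moreover have "ennreal (k * \<bar>y - x\<bar>) \<le> emeasure lborel (B (x, \<bar>y - x\<bar>))"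
      using order_trans[OF y(4) homeomorphism01_image_cball_bounds(3)[OF hom \<open>x \<in> {0..1}\<close> y(1) order_refl]]
      by (simp add: B_def homeomorphism01_image_cball_bounds(2)[OF hom] ennreal_leI)
    ultimately have "(x, \<bar>y - x\<bar>) \<in> K"
      using y by (simp add: K_def)
    then show ?thesis
      using y by (intro exI[of _ "(x, \<bar>y - x\<bar>)"]) auto
  qed
  obtain C where C: "countable C" "C \<subseteq> K"
     "pairwise (\<lambda>i j. disjnt (cball (fst i) (snd i)) (cball (fst j) (snd j))) C"
     "negligible (?E - (\<Union>i \<in> C. cball (fst i) (snd i)))"
    using Vitali_covering_theorem_cballs[of K snd ?E fst] cover by (force simp: K_def)
  let ?V = "\<Union>i \<in> C. cball (fst i) (snd i)"
  have dis: "disjoint_family_on (\<lambda>i. cball (fst i) (snd i)) C"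
    using C(3) by (auto simp: disjoint_family_on_def pairwise_def disjnt_def)
  have disB: "disjoint_family_on B C"
  proof (unfold disjoint_family_on_def, intro ballI impI)
    fix i j assume ij: "i \<in> C" "j \<in> C" "i \<noteq> j"
    then have "cball (fst i) (snd i) \<inter> cball (fst j) (snd j) = {}"
      using dis by (auto simp: disjoint_family_on_def)
    then show "B i \<inter> B j = {}"
      using homeomorphism01_inj_on[OF hom] unfolding B_def
      by (auto simp: case_prod_beta inj_on_def)
  qed
  have Vm: "?V \<in> sets borel"
    using C(1) by (intro sets.countable_UN') auto
  have "emeasure lborel ?V = (\<integral>\<^sup>+ i. emeasure lborel (cball (fst i) (snd i)) \<partial>count_space C)"
    using C(1) dis by (intro emeasure_UN_countable) auto
  also have "\<dots> \<le> (\<integral>\<^sup>+ i. ennreal (2 / k) * emeasure lborel (B i) \<partial>count_space C)"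
  proof (rule nn_integral_mono)
    fix i assume "i \<in> space (count_space C)"
    then have "i \<in> K" using C(2) by auto
    then have i: "snd i > 0" "ennreal (k * snd i) \<le> emeasure lborel (B i)"
      by (auto simp: K_def)
    have "emeasure lborel (cball (fst i) (snd i)) = ennreal (2 / k * (k * snd i))"
      using i \<open>k > 0\<close> by (simp add: cball_eq_atLeastAtMost)
    also have "\<dots> = ennreal (2 / k) * ennreal (k * snd i)"
      using i \<open>k > 0\<close> by (intro ennreal_mult) auto
    also have "\<dots> \<le> ennreal (2 / k) * emeasure lborel (B i)"
      using i by (intro mult_left_mono) auto
    finally show "emeasure lborel (cball (fst i) (snd i)) \<le> \<dots>" .
  qed
  also have "\<dots> = ennreal (2 / k) * (\<integral>\<^sup>+ i. emeasure lborel (B i) \<partial>count_space C)"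
    by (rule nn_integral_cmult) simp
  also have "(\<integral>\<^sup>+ i. emeasure lborel (B i) \<partial>count_space C) = emeasure lborel (\<Union>i\<in>C. B i)"
    using C(1) disB Bm by (intro emeasure_UN_countable[symmetric]) auto
  also have "\<dots> \<le> emeasure lborel U"
    using C(2) U(1) by (intro emeasure_mono) (auto simp: K_def)
  also have "\<dots> \<le> ennreal (k * e / 2)"
    using U(3) by simp
  also have "ennreal (2 / k) * ennreal (k * e / 2) = ennreal e"
    using \<open>k > 0\<close> \<open>e > 0\<close> by (simp flip: ennreal_mult)
  finally have V: "emeasure lborel ?V \<le> ennreal e"
    by (simp add: mult_left_mono)
  \<comment> \<open>The selected balls miss only a negligible part of \<open>?E\<close>; adding it
    back gives a measurable cover of the same measure.\<close>
  let ?T = "?V \<union> (?E - ?V)"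
  have VL: "?V \<in> lmeasurable"
    using Vm V by (intro fmeasurableI) (auto simp: le_less_trans)
  have "measure lebesgue ?T \<le> measure lebesgue ?V + measure lebesgue (?E - ?V)"
    using VL C(4) by (intro measure_Un_le) (auto simp: negligible_imp_sets)
  also have "\<dots> = measure lborel ?V"
    using C(4) Vm by (simp add: negligible_imp_measure0 measure_completion)
  also have "\<dots> \<le> e"
    using V \<open>e > 0\<close> by (simp add: measure_def enn2real_leI)
  finally have "measure lebesgue ?T \<le> e" .
  moreover have "?T \<in> lmeasurable"
    by (rule fmeasurable.Un[OF VL negligible_imp_measurable[OF C(4)]])
  ultimately show "\<exists>T. ?E \<subseteq> T \<and> T \<in> lmeasurable \<and> measure lebesgue T \<le> e"
    by (intro exI[of _ ?T]) blast
qed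

text \<open>At a point of \<open>F\<close> where the derivative is not 0, some threshold
  \<open>1 / (n + 1)\<close> is reached by difference quotients at arbitrarily small scales. So the
  exceptional points of \<open>F\<close> lie in a countable union of negligible sets.\<close>

lemma strongly_singular_if_singular:
  assumes hom: "homeomorphism {0..1} {0..1} f g" and "singular_fun f"
  shows "strongly_singular f"
proof -
  obtain F where F: "F \<in> sets borel" "F \<subseteq> {0..1}" "emeasure lborel ({0..1} - F) = 0"
    "emeasure lborel (f ` F) = 0"
    using assms(2) unfolding singular_fun_def by blast
  define E where "E = (\<lambda>k. {x \<in> F. \<forall>d>0. \<exists>y\<in>{0..1}. y \<noteq> x \<and> \<bar>y - x\<bar> < d \<and> k * \<bar>y - x\<bar> \<le> \<bar>f y - f x\<bar>})"
  have "negligible (\<Union>n. E (inverse (real (Suc n))))"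
    using negligible_large_derivates[OF hom F(1,2,4)]
    by (intro negligible_countable_Union) (auto simp: E_def)
  \<comment> \<open>Negligibility refers to the completed measure; \<open>N\<close> is a Borel null
    set containing the union.\<close>
  then obtain N where N: "N \<in> null_sets lborel" "(\<Union>n. E (inverse (real (Suc n)))) \<subseteq> N"
    unfolding negligible_iff_null_sets null_sets_completion_iff2 by blast
  have deriv: "(f has_real_derivative 0) (at x within {0..1})" if "x \<in> F - N" for x
  proof -
    have "((\<lambda>y. (f y - f x) / (y - x)) \<longlongrightarrow> 0) (at x within {0..1})"
    proof (rule tendstoI)
      fix e :: real assume "e > 0"
      then obtain n where n: "inverse (real (Suc n)) < e"
        using reals_Archimedean by blast
      have "x \<notin> E (inverse (real (Suc n)))" "x \<in> F" using N(2) that by blast+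
      then obtain d where d: "d > 0" "\<not> (\<exists>y\<in>{0..1}. y \<noteq> x \<and> \<bar>y - x\<bar> < d
          \<and> inverse (real (Suc n)) * \<bar>y - x\<bar> \<le> \<bar>f y - f x\<bar>)"
        unfolding E_def by blast
      have "dist ((f y - f x) / (y - x)) 0 < e" if y: "y \<in> {0..1}" "y \<noteq> x" "dist y x < d" for y
      proof -
        have "\<bar>f y - f x\<bar> / \<bar>y - x\<bar> < inverse (real (Suc n))"
          using d(2) y by (force simp: pos_divide_less_eq dist_real_def simp del: of_nat_Suc)
        then show ?thesis using n by simp
      qed
      then show "\<forall>\<^sub>F y in at x within {0..1}. dist ((f y - f x) / (y - x)) 0 < e"
        unfolding eventually_at using d(1) by auto
    qed
    then show ?thesis by (simp add: has_field_derivative_iff)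
  qed
  have "{0..1} - F \<in> null_sets lborel"
    using F by (intro null_setsI) auto
  then have "({0..1} - F) \<union> N \<in> null_sets lborel"
    using N(1) by blast
  then show ?thesis
    unfolding strongly_singular_def by (rule AE_I') (use deriv in auto)
qed

lemma strongly_singular_iff_singular:
  assumes "homeomorphism {0..1} {0..1} f g"
  shows "strongly_singular f \<longleftrightarrow> singular_fun f"
  using assms singular_if_strongly_singular strongly_singular_if_singular by blast

section \<open>Inverses, pushforward measures and densities\<close>

text \<open>Complementation swaps the two null sets: the complement in \<open>{0..1}\<close> of the
  image of \<open>F\<close> is a witness for \<open>g\<close>, because \<open>g\<close> maps it onto
  \<open>{0..1} - F\<close>.\<close>

lemma singular_fun_inverse:
  assumes hom: "homeomorphism {0..1} {0..1} f g" and "singular_fun f"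
  shows "singular_fun g"
proof -
  obtain F where F: "F \<in> sets borel" "F \<subseteq> {0..1}" "emeasure lborel ({0..1} - F) = 0"
    "emeasure lborel (f ` F) = 0"
    using assms(2) unfolding singular_fun_def by blast
  have "f ` F \<in> sets borel" "f ` F \<subseteq> {0..1}"
    using homeomorphism01_image_borel[OF hom F(1,2)] hom F(2) by (auto simp: homeomorphism_def)
  moreover have "g ` ({0..1} - f ` F) = {0..1} - F"
  proof -
    have "g ` {0..1} = {0..1}"
      using hom by (simp add: homeomorphism_def)
    moreover have "g ` f ` F = F"
    proof -
      have "g (f x) = x" if "x \<in> F" for x
        using hom F(2) that by (auto simp: homeomorphism_def)
      then show ?thesis by (simp add: image_image)
    qed
    moreover have "inj_on g {0..1}"
      using homeomorphism01_inj_on[OF homeomorphism_symD[OF hom]] .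
    ultimately show ?thesis
      using \<open>f ` F \<subseteq> {0..1}\<close> inj_on_image_set_diff[of g "{0..1}" "{0..1}" "f ` F"] by simp
  qed
  moreover have "{0..1} - ({0..1} - f ` F) = f ` F"
    using \<open>f ` F \<subseteq> {0..1}\<close> by blast
  ultimately show ?thesis
    unfolding singular_fun_def using F by (intro bexI[of _ "{0..1} - f ` F"]) auto
qed

text \<open>A separating set \<open>A\<close> and a witness \<open>F\<close> determine each other by
  complements: \<open>F\<close> is the preimage of \<open>- A\<close>, and \<open>A\<close> is the
  complement of the image of \<open>F\<close>.\<close>

lemma singular_fun_iff_mutually_singular:
  assumes hom: "homeomorphism {0..1} {0..1} f g"
  shows "mutually_singular (pushforward01 f) lborel \<longleftrightarrow> singular_fun f"
proof -
  have "f \<in> Homeo01" using hom by (auto simp: Homeo01_def)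
  note em = emeasure_pushforward01[OF this]
  have s: "sets (pushforward01 f) = sets borel" by (simp add: pushforward01_def)
  show ?thesis
  proof
    assume "mutually_singular (pushforward01 f) lborel"
    then obtain A where A: "A \<in> sets borel" "emeasure (pushforward01 f) A = 0"
      "emeasure lborel (space lborel - A) = 0"
      unfolding mutually_singular_def s by blast
    then have A: "A \<in> sets borel" "emeasure lborel (preimage01 f A) = 0" "emeasure lborel (- A) = 0"
      using em[OF A(1)] by (simp_all add: Compl_eq_Diff_UNIV)
    let ?F = "preimage01 f (- A)"
    have "{0..1} - ?F = preimage01 f A" "?F \<subseteq> {0..1}" by (auto simp: preimage01_def)
    moreover have "emeasure lborel (f ` ?F) \<le> emeasure lborel (- A)"
      using A(1) by (intro emeasure_mono) (auto simp: preimage01_def)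
    moreover have "?F \<in> sets borel"
      using A(1) hom by (intro preimage01_borel) (auto simp: homeomorphism_def)
    ultimately show "singular_fun f"
      unfolding singular_fun_def using A by (intro bexI[of _ ?F]) simp_all
  next
    assume "singular_fun f"
    then obtain F where F: "F \<in> sets borel" "F \<subseteq> {0..1}" "emeasure lborel ({0..1} - F) = 0"
      "emeasure lborel (f ` F) = 0"
      unfolding singular_fun_def by blast
    have "- (f ` F) \<in> sets borel"
      using homeomorphism01_image_borel[OF hom F(1,2)] by auto
    moreover have "preimage01 f (- (f ` F)) = {0..1} - F"
      using homeomorphism01_inj_on[OF hom] F(2) by (auto simp: preimage01_def inj_on_def)
    moreover have "UNIV - (- (f ` F)) = f ` F" by blast
    ultimately show "mutually_singular (pushforward01 f) lborel"
      unfolding mutually_singular_def s using em F(3,4) by (intro conjI bexI[of _ "- (f ` F)"]) auto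
  qed
qed

lemma strongly_singular_iff_image_density:
  assumes "homeomorphism {0..1} {0..1} f g"
  shows "strongly_singular f \<longleftrightarrow> (AE x in lborel. x \<in> {0..1} \<longrightarrow>
    ((\<lambda>r. measure lborel (f ` (cball x r \<inter> {0..1})) / measure lborel (cball x r)) \<longlongrightarrow> 0) (at_right 0))"
  unfolding strongly_singular_def
  using has_real_derivative_0_iff_image_density[OF assms] by (intro AE_cong) auto

lemma strongly_singular_inverse_iff_preimage_density:
  assumes "homeomorphism {0..1} {0..1} f g"
  shows "strongly_singular g \<longleftrightarrow> (AE y in lborel.
    ((\<lambda>r. measure lborel (preimage01 f (cball y r)) / measure lborel (cball y r)) \<longlongrightarrow> 0) (at_right 0))"
proof -
  have hom': "homeomorphism {0..1} {0..1} g f"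
    using homeomorphism_symD[OF assms] .
  have im: "g ` (cball y r \<inter> {0..1}) = preimage01 f (cball y r)" for y r
  proof -
    have "g ` (cball y r \<inter> {0..1}) = preimage01 f (cball y r \<inter> {0..1})"
      by (rule homeomorphism01_image_eq_preimage01[OF hom']) auto
    also have "\<dots> = preimage01 f (cball y r)"
      using assms unfolding preimage01_def homeomorphism_def by blast
    finally show ?thesis .
  qed
  \<comment> \<open>Outside \<open>{0..1}\<close> small balls have empty preimage, so a condition on
    all real \<open>y\<close> amounts to one on \<open>{0..1}\<close>.\<close>
  have outside: "((\<lambda>r. measure lborel (preimage01 f (cball y r)) / measure lborel (cball y r)) \<longlongrightarrow> 0) (at_right 0)"
    if "y \<notin> {0..1}" for y
  proof (rule tendsto_eventually)
    have "open (- {0..1::real})" by auto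
    then obtain e where "e > 0" "ball y e \<subseteq> - {0..1}"
      using \<open>y \<notin> {0..1}\<close> open_contains_ball by blast
    have "preimage01 f (cball y r) = {}" if "r < e" for r
    proof -
      have "cball y r \<subseteq> ball y e" using that by auto
      with \<open>ball y e \<subseteq> - {0..1}\<close> have "cball y r \<inter> {0..1} = {}" by blast
      then show ?thesis by (simp flip: im)
    qed
    then show "\<forall>\<^sub>F r in at_right 0. measure lborel (preimage01 f (cball y r)) / measure lborel (cball y r) = 0"
      using \<open>e > 0\<close> by (auto simp: eventually_at_right_field intro!: exI[of _ e])
  qed
  show ?thesis
    unfolding strongly_singular_iff_image_density[OF hom'] im
    using outside by (intro AE_cong) blast
qed


section \<open>Length of the graph\<close>

text \<open>The index set of the supremum in \<open>graph_length\<close>; values \<open>x i\<close>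
  with \<open>i > n\<close> are arbitrary.\<close>

definition partition01 :: "nat \<Rightarrow> (nat \<Rightarrow> real) \<Rightarrow> bool" where
  "partition01 n x \<longleftrightarrow> 1 \<le> n \<and> x 0 = 0 \<and> x n = 1 \<and> (\<forall>i\<in>{1..n}. x (i - 1) < x i)"

lemma partition01_mono:
  assumes "partition01 n x" "i \<le> j" "j \<le> n"
  shows "x i \<le> x j"
  using assms(2,3)
proof (induction j rule: dec_induct)
  case (step j)
  then have "x j < x (Suc j)"
    using assms(1) unfolding partition01_def by (metis Suc_le_eq atLeastAtMost_iff diff_Suc_1 le_add1 plus_1_eq_Suc)
  with step show ?case by simp
qed simp

lemma partition01_range:
  assumes "partition01 n x" "i \<le> n"
  shows "x i \<in> {0..1}"
  using partition01_mono[OF assms(1), of 0 i] partition01_mono[OF assms(1), of i n] assms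
  by (auto simp: partition01_def)

lemma partition01_cover:
  assumes "partition01 n x" "t \<in> {0..1}"
  obtains i where "i \<in> {1..n}" "t \<in> {x (i - 1)..x i}"
proof -
  \<comment> \<open>Generalised to initial parts of the partition, so that induction
    applies.\<close>
  have "t \<le> x k \<Longrightarrow> k \<le> n \<Longrightarrow> 1 \<le> k \<Longrightarrow> \<exists>i\<in>{1..k}. t \<in> {x (i - 1)..x i}" for k
  proof (induction k)
    case (Suc k)
    show ?case
    proof (cases "1 \<le> k \<and> t \<le> x k")
      case True
      then show ?thesis using Suc by (metis Suc_leD atLeastAtMost_iff le_SucI)
    next
      case False
      \<comment> \<open>For \<open>k = 0\<close> the bound comes from \<open>x 0 = 0\<close>,
        otherwise from the failed comparison.\<close>
      then have "x k \<le> t" using assms by (cases k) (auto simp: partition01_def)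
      then show ?thesis using Suc.prems by (intro bexI[of _ "Suc k"]) auto
    qed
  qed simp
  from this[of n] obtain i where "i \<in> {1..n}" "t \<in> {x (i - 1)..x i}"
    using assms unfolding partition01_def by auto
  then show thesis by (rule that)
qed

lemma graph_length_partition01:
  "graph_length f = (SUP (n, x) \<in> {(n, x). partition01 n x}.
     ennreal (\<Sum>i = 1..n. sqrt ((x i - x (i - 1))\<^sup>2 + (f (x i) - f (x (i - 1)))\<^sup>2)))"
  unfolding graph_length_def partition01_def by (simp add: norm_Pair)

lemma partition01_sum_steps: "partition01 n x \<Longrightarrow> (\<Sum>i = 1..n. x i - x (i - 1)) = 1"
  using sum_telescope''[of 0 n x] by (auto simp: partition01_def)

text \<open>A continuous injection on an interval is strictly monotone, so all increments have one
  sign and their absolute values telescope to \<open>\<bar>f 1 - f 0\<bar>\<close>.\<close>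

lemma partition01_sum_increments:
  fixes f g :: "real \<Rightarrow> real"
  assumes hom: "homeomorphism {0..1} {0..1} f g" and P: "partition01 n x"
  shows "(\<Sum>i = 1..n. \<bar>f (x i) - f (x (i - 1))\<bar>) \<le> 1"
proof -
  have "continuous_on {0..1} f" "is_interval {0..1::real}"
    using hom by (auto simp: homeomorphism_def is_interval_cc)
  then have mono: "strict_mono_on {0..1} f \<or> strict_antimono_on {0..1} f"
    using injective_eq_monotone_map[of "{0..1}" f] homeomorphism01_inj_on[OF hom] by simp
  have rng: "x i \<in> {0..1}" "x (i - 1) \<in> {0..1}" "x (i - 1) < x i" if "i \<in> {1..n}" for i
    using that P partition01_range[OF P] by (auto simp: partition01_def)
  have *: "\<bar>\<Sum>i = 1..n. f (x i) - f (x (i - 1))\<bar> = \<bar>f 1 - f 0\<bar>"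
    using sum_telescope''[of 0 n "\<lambda>i. f (x i)"] P by (auto simp: partition01_def)
  have "(\<Sum>i = 1..n. \<bar>f (x i) - f (x (i - 1))\<bar>) = \<bar>\<Sum>i = 1..n. f (x i) - f (x (i - 1))\<bar>"
    using mono
  proof
    assume "strict_mono_on {0..1} f"
    then have nn: "f (x i) - f (x (i - 1)) \<ge> 0" if "i \<in> {1..n}" for i
      using rng[OF that] unfolding monotone_on_def by force
    then have "(\<Sum>i = 1..n. \<bar>f (x i) - f (x (i - 1))\<bar>) = (\<Sum>i = 1..n. f (x i) - f (x (i - 1)))"
      by (intro sum.cong refl abs_of_nonneg)
    moreover have "0 \<le> (\<Sum>i = 1..n. f (x i) - f (x (i - 1)))"
      by (rule sum_nonneg[OF nn])
    ultimately show ?thesis by linarith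
  next
    assume "strict_antimono_on {0..1} f"
    then have np: "f (x i) - f (x (i - 1)) \<le> 0" if "i \<in> {1..n}" for i
      using rng[OF that] unfolding monotone_on_def by force
    then have "(\<Sum>i = 1..n. \<bar>f (x i) - f (x (i - 1))\<bar>) = (\<Sum>i = 1..n. - (f (x i) - f (x (i - 1))))"
      by (intro sum.cong refl abs_of_nonpos)
    moreover have "(\<Sum>i = 1..n. f (x i) - f (x (i - 1))) \<le> 0"
      by (rule sum_nonpos[OF np])
    ultimately show ?thesis unfolding sum_negf by linarith
  qed
  also have "\<dots> \<le> 1"
  proof -
    have "f 0 \<in> {0..1}" "f 1 \<in> {0..1}" using hom by (auto simp: homeomorphism_def)
    then show ?thesis unfolding * by auto
  qed
  finally show ?thesis .
qed

section \<open>Singularity implies length 2\<close>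

text \<open>Each hypotenuse is at most the sum of its legs, and the legs in either direction sum to
  at most 1.\<close>

lemma graph_length_le_2:
  assumes hom: "homeomorphism {0..1} {0..1} f g"
  shows "graph_length f \<le> 2"
  unfolding graph_length_partition01
proof (rule SUP_least, clarify)
  fix n x assume P: "partition01 n x"
  have "(\<Sum>i = 1..n. sqrt ((x i - x (i - 1))\<^sup>2 + (f (x i) - f (x (i - 1)))\<^sup>2))
     \<le> (\<Sum>i = 1..n. (x i - x (i - 1)) + \<bar>f (x i) - f (x (i - 1))\<bar>)"
    using P by (intro sum_mono order_trans[OF sqrt_sum_squares_le_sum_abs]) (auto simp: partition01_def less_imp_le)
  also have "\<dots> \<le> 2"
    using partition01_sum_steps[OF P] partition01_sum_increments[OF hom P] by (simp add: sum.distrib)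
  finally show "ennreal (\<Sum>i = 1..n. sqrt ((x i - x (i - 1))\<^sup>2 + (f (x i) - f (x (i - 1)))\<^sup>2)) \<le> 2"
    using ennreal_leI[of _ 2] by simp
qed

text \<open>Subadditivity, with \<open>T\<close> as a small remainder. It serves twice: for the
  partition intervals on the horizontal axis and for their images on the vertical axis.\<close>

lemma sum_ge_of_cover:
  fixes S :: "real set"
  assumes "finite I" "S \<in> sets borel" "S \<subseteq> T \<union> (\<Union>i\<in>I. closed_segment (a i) (b i))"
    and "T \<in> sets borel" "emeasure lborel T \<le> ennreal e" "0 \<le> e" "ennreal s \<le> emeasure lborel S"
  shows "s \<le> e + (\<Sum>i\<in>I. \<bar>b i - a i\<bar>)"
proof -
  have "ennreal s \<le> emeasure lborel (T \<union> (\<Union>i\<in>I. closed_segment (a i) (b i)))"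
    using assms by (intro order_trans[OF assms(7) emeasure_mono]) (auto intro!: sets.finite_UN)
  also have "\<dots> \<le> emeasure lborel T + emeasure lborel (\<Union>i\<in>I. closed_segment (a i) (b i))"
    using assms by (intro emeasure_subadditive) (auto intro!: sets.finite_UN)
  also have "\<dots> \<le> ennreal e + (\<Sum>i\<in>I. emeasure lborel (closed_segment (a i) (b i)))"
    using assms by (intro add_mono emeasure_subadditive_finite) auto
  also have "\<dots> = ennreal (e + (\<Sum>i\<in>I. \<bar>b i - a i\<bar>))"
    using assms by (simp add: emeasure_lborel_closed_segment sum_nonneg)
  finally show ?thesis
    using assms by (subst (asm) ennreal_le_iff) (auto intro!: add_nonneg_nonneg sum_nonneg)
qed

text \<open>A compact \<open>K\<close> inside \<open>F\<close> has positive distance from the points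
  that \<open>f\<close> sends outside \<open>U\<close>. With a mesh below this distance, every
  interval meeting \<open>K\<close> is mapped into \<open>U\<close>. These intervals cover
  \<open>K\<close>, while the images of the others cover \<open>{0..1} - U\<close>.\<close>

lemma graph_length_if_singular:
  assumes hom: "homeomorphism {0..1} {0..1} f g" and "singular_fun f"
  shows "graph_length f = 2"
proof (rule antisym[OF graph_length_le_2[OF hom]])
  obtain F where F: "F \<in> sets borel" "F \<subseteq> {0..1}" "emeasure lborel ({0..1} - F) = 0"
    "emeasure lborel (f ` F) = 0"
    using assms(2) unfolding singular_fun_def by blast
  note fF = homeomorphism01_image_borel[OF hom F(1,2)]
  have contf: "continuous_on {0..1} f" using hom by (simp add: homeomorphism_def)
  show "2 \<le> graph_length f"
  proof (rule ennreal_le_epsilon)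
    fix e :: real assume "0 < e"
    obtain U where U: "open U" "f ` F \<subseteq> U" "emeasure lborel (U - f ` F) < ennreal (e / 2)"
      using outer_regular_lborel[OF fF, of "e / 2"] \<open>e > 0\<close> by auto
    have "emeasure lborel U = emeasure lborel (U - f ` F)"
      using F(4) fF \<open>open U\<close> by (intro emeasure_Diff_null_set[symmetric]) auto
    with U(3) have Ue: "emeasure lborel U \<le> ennreal (e / 2)" by simp
    obtain K where K: "closed K" "K \<subseteq> F" "emeasure lebesgue (F - K) < ennreal (e / 2)"
      using sets_lebesgue_inner_closed[of F "e / 2"] F(1) \<open>e > 0\<close>
      by (metis half_gt_zero sets_completionI_sets sets_lborel)
    have "compact K"
      using K(1,2) F(2) by (meson bounded_closed_interval bounded_subset compact_eq_bounded_closed subset_trans)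
    have Km: "K \<in> sets borel" using K(1) by simp
    have "preimage01 f (- U) = {0..1} \<inter> f -` (- U)"
      by (auto simp: preimage01_def)
    then have "closed (preimage01 f (- U))"
      using continuous_closed_preimage[OF contf, of "- U"] U(1) by (simp add: closed_Compl)
    moreover have "K \<inter> preimage01 f (- U) = {}"
      using K(2) U(2) by (auto simp: preimage01_def)
    ultimately obtain d where d: "d > 0" "\<And>x y. \<lbrakk>x \<in> K; y \<in> preimage01 f (- U)\<rbrakk> \<Longrightarrow> d \<le> dist x y"
      using separate_compact_closed[OF \<open>compact K\<close>] by meson
    obtain m where m: "inverse (real (Suc m)) < d"
      using reals_Archimedean \<open>d > 0\<close> by blast
    \<comment> \<open>The mesh \<open>1 / n\<close> is below the separation distance
      \<open>d\<close>.\<close>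
    define n where "n = Suc m"
    define x where "x = (\<lambda>i. real i / real n)"
    have step: "x i - x (i - 1) = inverse (real n)" if "i \<in> {1..n}" for i
      using that by (auto simp: x_def n_def of_nat_diff diff_divide_distrib[symmetric] inverse_eq_divide)
    have P: "partition01 n x"
      unfolding partition01_def
    proof (intro conjI ballI)
      show "x (i - 1) < x i" if "i \<in> {1..n}" for i
      proof -
        have "0 < inverse (real n)" by (simp add: n_def)
        with step[OF that] show ?thesis by linarith
      qed
    qed (auto simp: x_def n_def)
    have rng: "x i \<in> {0..1}" "x (i - 1) \<in> {0..1}" "x (i - 1) < x i" if "i \<in> {1..n}" for i
      using that P partition01_range[OF P] by (auto simp: partition01_def)
    define I where "I = {i \<in> {1..n}. {x (i - 1)..x i} \<inter> K \<noteq> {}}"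
    have inU: "f t \<in> U" if "i \<in> I" "t \<in> {x (i - 1)..x i}" for i t
    proof (rule ccontr)
      assume "f t \<notin> U"
      have i: "i \<in> {1..n}" using that by (auto simp: I_def)
      then have "t \<in> preimage01 f (- U)"
        using \<open>f t \<notin> U\<close> that rng[OF i] by (auto simp: preimage01_def)
      moreover obtain s where "s \<in> K" "s \<in> {x (i - 1)..x i}"
        using \<open>i \<in> I\<close> unfolding I_def by blast
      ultimately have "d \<le> dist s t" using d(2) by blast
      also have "\<dots> \<le> inverse (real n)"
        using step[OF i] that(2) \<open>s \<in> {x (i - 1)..x i}\<close> by (auto simp: dist_real_def)
      finally show False using m by (simp add: n_def)
    qed
    have hK: "1 \<le> e / 2 + (\<Sum>i\<in>I. \<bar>x i - x (i - 1)\<bar>)"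
    proof (rule sum_ge_of_cover[where T = "{0..1} - K" and S = "{0..1}"])
      have "{0..1} - K \<subseteq> ({0..1} - F) \<union> (F - K)" by blast
      then have "emeasure lborel ({0..1} - K) \<le> emeasure lborel (({0..1} - F) \<union> (F - K))"
        using F(1) Km by (intro emeasure_mono) auto
      also have "\<dots> \<le> emeasure lborel ({0..1} - F) + emeasure lborel (F - K)"
        using F(1) Km by (intro emeasure_subadditive) auto
      also have "\<dots> \<le> ennreal (e / 2)"
        using F(1,3) K(3) Km by simp
      finally show "emeasure lborel ({0..1} - K) \<le> ennreal (e / 2)" .
      show "{0..1} \<subseteq> {0..1} - K \<union> (\<Union>i\<in>I. closed_segment (x (i - 1)) (x i))"
      proof
        fix t :: real assume t: "t \<in> {0..1}"
        then obtain i where i: "i \<in> {1..n}" "t \<in> {x (i - 1)..x i}"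
          using partition01_cover[OF P] by blast
        then have "t \<in> closed_segment (x (i - 1)) (x i)"
          by (simp add: closed_segment_eq_real_ivl)
        moreover have "i \<in> I" if "t \<in> K"
          using i that unfolding I_def by blast
        ultimately show "t \<in> {0..1} - K \<union> (\<Union>i\<in>I. closed_segment (x (i - 1)) (x i))"
          using t by blast
      qed
    qed (use Km \<open>e > 0\<close> in \<open>auto simp: I_def\<close>)
    \<comment> \<open>By \<open>inU\<close>, a value outside \<open>U\<close> can only be attained
      on an interval outside \<open>I\<close>.\<close>
    have hU: "1 \<le> e / 2 + (\<Sum>i\<in>{1..n} - I. \<bar>f (x i) - f (x (i - 1))\<bar>)"
    proof (rule sum_ge_of_cover[where T = U and S = "{0..1}"])
      show "{0..1} \<subseteq> U \<union> (\<Union>i\<in>{1..n} - I. closed_segment (f (x (i - 1))) (f (x i)))"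
      proof
        fix s :: real assume "s \<in> {0..1}"
        then have "s \<in> f ` {0..1}" using homeomorphism_image1[OF hom] by simp
        then obtain t where t: "t \<in> {0..1}" "s = f t" by blast
        then obtain i where i: "i \<in> {1..n}" "t \<in> {x (i - 1)..x i}"
          using partition01_cover[OF P] by blast
        have "f t \<in> closed_segment (f (x (i - 1))) (f (x i))"
          using homeomorphism01_image_segment[OF hom rng(2,1)[OF i(1)]] i(2)
          by (auto simp: closed_segment_eq_real_ivl)
        then show "s \<in> U \<union> (\<Union>i\<in>{1..n} - I. closed_segment (f (x (i - 1))) (f (x i)))"
          using i inU t(2) by (cases "i \<in> I") auto
      qed
    qed (use U Ue \<open>e > 0\<close> in auto)
    let ?l = "\<lambda>i. sqrt ((x i - x (i - 1))\<^sup>2 + (f (x i) - f (x (i - 1)))\<^sup>2)"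
    have "2 \<le> e + ((\<Sum>i\<in>I. \<bar>x i - x (i - 1)\<bar>) + (\<Sum>i\<in>{1..n} - I. \<bar>f (x i) - f (x (i - 1))\<bar>))"
      using hK hU by simp
    \<comment> \<open>The hypotenuse dominates either leg: the horizontal one is used on
      \<open>I\<close>, the vertical one elsewhere.\<close>
    also have "\<dots> \<le> e + ((\<Sum>i\<in>I. ?l i) + (\<Sum>i\<in>{1..n} - I. ?l i))"
      by (intro add_mono sum_mono order_refl) (simp_all add: real_le_rsqrt)
    also have "(\<Sum>i\<in>I. ?l i) + (\<Sum>i\<in>{1..n} - I. ?l i) = (\<Sum>i = 1..n. ?l i)"
      by (subst add.commute, rule sum.subset_diff[symmetric]) (auto simp: I_def)
    finally have "ennreal 2 \<le> ennreal ((\<Sum>i = 1..n. ?l i) + e)"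
      by (intro ennreal_leI) simp
    also have "\<dots> = ennreal (\<Sum>i = 1..n. ?l i) + ennreal e"
      using \<open>e > 0\<close> by (intro ennreal_plus sum_nonneg) auto
    also have "ennreal (\<Sum>i = 1..n. ?l i) \<le> graph_length f"
      unfolding graph_length_partition01 using P by (intro SUP_upper2[of "(n, x)"]) auto
    finally show "2 \<le> graph_length f + ennreal e"
      by (simp add: add_right_mono)
  qed
qed

section \<open>Length 2 implies singularity\<close>

text \<open>With \<open>m = min a b\<close>, squaring reduces the claim to
  \<open>m * (a + b) \<le> 2 * a * b\<close>, which holds since \<open>a * b\<close> is
  \<open>m\<close> times the larger of the two.\<close>

lemma min_le_excess:
  fixes a b :: real
  assumes "0 \<le> a" "0 \<le> b"
  shows "min a b \<le> 2 * (a + b - sqrt (a\<^sup>2 + b\<^sup>2))"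
proof -
  have "sqrt (a\<^sup>2 + b\<^sup>2) \<le> a + b - min a b / 2"
  proof (rule real_le_lsqrt)
    show "0 \<le> a + b - min a b / 2" using assms by (auto simp: min_def)
    have "min a b * (a + b) \<le> 2 * a * b"
      using assms mult_right_mono[of a b a] mult_right_mono[of b a b]
      by (auto simp: min_def algebra_simps)
    moreover have "(a + b - m / 2)\<^sup>2 = a\<^sup>2 + b\<^sup>2 + 2 * a * b - m * (a + b) + m\<^sup>2 / 4" for m
      by (simp add: power2_eq_square field_simps)
    moreover have "0 \<le> (min a b)\<^sup>2 / 4" by simp
    ultimately show "a\<^sup>2 + b\<^sup>2 \<le> (a + b - min a b / 2)\<^sup>2" by smt
  qed
  then show ?thesis by simp
qed

text \<open>Take \<open>H\<close> to be the union of the flat intervals, those with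
  \<open>b i < a i\<close>. There the minimum of the two steps is the length of the image; on the
  other intervals it is the length of the interval itself. The sum of the minima thus controls both
  the image of \<open>H\<close> and the complement of \<open>H\<close>.\<close>

lemma singular_approx_if_graph_length:
  assumes hom: "homeomorphism {0..1} {0..1} f g" and len: "graph_length f = 2" and "e > 0"
  obtains H where "H \<in> sets borel" "H \<subseteq> {0..1}" "emeasure lborel ({0..1} - H) \<le> ennreal e"
    "emeasure lborel (f ` H) \<le> ennreal e"
proof -
  \<comment> \<open>A length defect below \<open>e / 2\<close> becomes \<open>e\<close> through the
    factor 2 in \<open>min_le_excess\<close>. For large \<open>e\<close> the left side is truncated
    to 0, which is harmless.\<close>
  have "ennreal (2 - e / 2) < 2"
    using \<open>e > 0\<close> ennreal_lessI[of 2 "2 - e / 2"] by simp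
  then have "\<exists>(n, x) \<in> {(n, x). partition01 n x}. ennreal (2 - e / 2) <
      ennreal (\<Sum>i = 1..n. sqrt ((x i - x (i - 1))\<^sup>2 + (f (x i) - f (x (i - 1)))\<^sup>2))"
    unfolding len[symmetric] graph_length_partition01 less_SUP_iff by (simp add: case_prod_beta)
  then obtain n x where P: "partition01 n x" and lt: "ennreal (2 - e / 2) <
      ennreal (\<Sum>i = 1..n. sqrt ((x i - x (i - 1))\<^sup>2 + (f (x i) - f (x (i - 1)))\<^sup>2))"
    by blast
  have "2 - e / 2 < (\<Sum>i = 1..n. sqrt ((x i - x (i - 1))\<^sup>2 + (f (x i) - f (x (i - 1)))\<^sup>2))"
    by (rule ccontr) (use lt in \<open>simp add: not_less ennreal_leI leD\<close>)
  moreover define a where "a = (\<lambda>i. x i - x (i - 1))"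
  moreover define b where "b = (\<lambda>i. \<bar>f (x i) - f (x (i - 1))\<bar>)"
  ultimately have L: "2 - e / 2 < (\<Sum>i = 1..n. sqrt ((a i)\<^sup>2 + (b i)\<^sup>2))"
    by simp
  have rng: "x i \<in> {0..1}" "x (i - 1) \<in> {0..1}" "x (i - 1) < x i" if "i \<in> {1..n}" for i
    using that P partition01_range[OF P] by (auto simp: partition01_def)
  have nonneg: "0 \<le> a i" "0 \<le> b i" if "i \<in> {1..n}" for i
    using rng(3)[OF that] by (simp_all add: a_def b_def)
  have "(\<Sum>i = 1..n. min (a i) (b i)) \<le> (\<Sum>i = 1..n. 2 * (a i + b i - sqrt ((a i)\<^sup>2 + (b i)\<^sup>2)))"
    by (intro sum_mono min_le_excess nonneg)
  also have "\<dots> = 2 * ((\<Sum>i = 1..n. a i) + (\<Sum>i = 1..n. b i) - (\<Sum>i = 1..n. sqrt ((a i)\<^sup>2 + (b i)\<^sup>2)))"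
    by (simp add: sum.distrib sum_subtractf flip: sum_distrib_left)
  also have "\<dots> \<le> e"
    using L partition01_sum_steps[OF P] partition01_sum_increments[OF hom P] by (simp add: a_def b_def)
  finally have min: "(\<Sum>i = 1..n. min (a i) (b i)) \<le> e" .
  have part: "(\<Sum>i\<in>J. min (a i) (b i)) \<le> e" if "J \<subseteq> {1..n}" for J
  proof (rule order_trans[OF sum_mono2 min])
    show "0 \<le> min (a i) (b i)" if "i \<in> {1..n} - J" for i
      using nonneg[of i] that by simp
  qed (use that in auto)
  define I where "I = {i \<in> {1..n}. b i < a i}"
  define J where "J = {1..n} - I"
  define H where "H = (\<Union>i\<in>I. closed_segment (x (i - 1)) (x i))"
  show thesis
  proof
    show "H \<in> sets borel" unfolding H_def I_def by (intro sets.finite_UN) auto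
    show "H \<subseteq> {0..1}"
      unfolding H_def
    proof (rule UN_least)
      fix i assume "i \<in> I"
      then have "i \<in> {1..n}" by (simp add: I_def)
      from rng[OF this] show "closed_segment (x (i - 1)) (x i) \<subseteq> {0..1}"
        by (auto simp: closed_segment_eq_real_ivl)
    qed
    have "{0..1} - H \<subseteq> (\<Union>i\<in>J. closed_segment (x (i - 1)) (x i))"
    proof
      fix t assume t: "t \<in> {0..1} - H"
      then obtain i where "i \<in> {1..n}" "t \<in> {x (i - 1)..x i}"
        using partition01_cover[OF P] by blast
      then have "i \<in> {1..n}" "t \<in> closed_segment (x (i - 1)) (x i)"
        by (simp_all add: closed_segment_eq_real_ivl)
      then show "t \<in> (\<Union>i\<in>J. closed_segment (x (i - 1)) (x i))"
        using t unfolding J_def H_def by blast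
    qed
    then have "emeasure lborel ({0..1} - H) \<le> emeasure lborel (\<Union>i\<in>J. closed_segment (x (i - 1)) (x i))"
      by (intro emeasure_mono) (auto simp: J_def intro!: sets.finite_UN)
    also have "\<dots> \<le> (\<Sum>i\<in>J. emeasure lborel (closed_segment (x (i - 1)) (x i)))"
      by (intro emeasure_subadditive_finite) (auto simp: J_def)
    also have "\<dots> = (\<Sum>i\<in>J. ennreal (min (a i) (b i)))"
    proof (rule sum.cong[OF refl])
      fix i assume "i \<in> J"
      then have "i \<in> {1..n}" "a i \<le> b i" by (auto simp: J_def I_def)
      with nonneg(1)[of i] show "emeasure lborel (closed_segment (x (i - 1)) (x i)) = ennreal (min (a i) (b i))"
        by (simp add: emeasure_lborel_closed_segment a_def)
    qed
    also have "\<dots> = ennreal (\<Sum>i\<in>J. min (a i) (b i))"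
    proof (rule sum_ennreal)
      show "0 \<le> min (a i) (b i)" if "i \<in> J" for i
        using nonneg[of i] that by (simp add: J_def)
    qed
    also have "\<dots> \<le> ennreal e"
      by (intro ennreal_leI part) (auto simp: J_def)
    finally show "emeasure lborel ({0..1} - H) \<le> ennreal e" .
    have "f ` H = (\<Union>i\<in>I. closed_segment (f (x (i - 1))) (f (x i)))"
      unfolding H_def image_UN I_def
      using homeomorphism01_image_segment[OF hom rng(2,1)] by (intro SUP_cong) auto
    also have "emeasure lborel \<dots> \<le> (\<Sum>i\<in>I. emeasure lborel (closed_segment (f (x (i - 1))) (f (x i))))"
      by (intro emeasure_subadditive_finite) (auto simp: I_def)
    also have "\<dots> = (\<Sum>i\<in>I. ennreal (min (a i) (b i)))"
    proof (rule sum.cong[OF refl])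
      fix i assume "i \<in> I"
      then have "b i \<le> a i" by (simp add: I_def)
      then show "emeasure lborel (closed_segment (f (x (i - 1))) (f (x i))) = ennreal (min (a i) (b i))"
        by (simp add: emeasure_lborel_closed_segment b_def)
    qed
    also have "\<dots> = ennreal (\<Sum>i\<in>I. min (a i) (b i))"
    proof (rule sum_ennreal)
      show "0 \<le> min (a i) (b i)" if "i \<in> I" for i
        using nonneg[of i] that by (simp add: I_def)
    qed
    also have "\<dots> \<le> ennreal e"
      by (intro ennreal_leI part) (auto simp: I_def)
    finally show "emeasure lborel (f ` H) \<le> ennreal e" .
  qed
qed

text \<open>The witness is the lower limit of sets \<open>H n\<close> with errors
  \<open>(1/2) ^ n\<close>. Its complement in \<open>{0..1}\<close> is an upper limit of sets with
  summable measures, hence null by Borel-Cantelli. Each \<open>A m\<close> lies in all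
  \<open>H n\<close> with \<open>n \<ge> m\<close>, so its image is null.\<close>

lemma singular_if_graph_length:
  assumes hom: "homeomorphism {0..1} {0..1} f g" and len: "graph_length f = 2"
  shows "singular_fun f"
proof -
  have "\<exists>H. H \<in> sets borel \<and> H \<subseteq> {0..1} \<and> emeasure lborel ({0..1} - H) \<le> ennreal ((1/2) ^ n)
    \<and> emeasure lborel (f ` H) \<le> ennreal ((1/2) ^ n)" for n :: nat
    by (rule singular_approx_if_graph_length[OF hom len, of "(1/2) ^ n"]) auto
  then obtain H where H: "\<And>n. H n \<in> sets borel" "\<And>n. H n \<subseteq> {0..1}"
    "\<And>n. emeasure lborel ({0..1} - H n) \<le> ennreal ((1/2) ^ n)"
    "\<And>n. emeasure lborel (f ` H n) \<le> ennreal ((1/2) ^ n)"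
    by metis
  define A where "A = (\<lambda>m. \<Inter>n\<in>{m..}. H n)"
  define F where "F = (\<Union>m. A m)"
  have Am: "A m \<in> sets borel" "A m \<subseteq> {0..1}" for m
    using H(1,2) by (auto simp: A_def intro!: sets.countable_INT')
  have Fm: "F \<in> sets borel" "F \<subseteq> {0..1}"
    using Am by (auto simp: F_def)
  have "limsup (\<lambda>n. {0..1} - H n) \<in> null_sets lborel"
  proof (rule borel_cantelli_limsup1)
    show "emeasure lborel ({0..1} - H n) < \<infinity>" for n
      using H(3)[of n] by (simp add: le_less_trans)
    have "measure lborel ({0..1} - H n) \<le> (1/2) ^ n" for n
      using H(3)[of n] by (simp add: measure_def enn2real_leI)
    then have "norm (measure lborel ({0..1} - H n)) \<le> (1/2) ^ n" for n
      by simp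
    moreover have "summable (\<lambda>n. (1/2) ^ n :: real)"
      by (rule summable_geometric) simp
    ultimately show "summable (\<lambda>n. measure lborel ({0..1} - H n))"
      by (rule summable_comparison_test'[rotated])
  qed (use H(1) in auto)
  moreover have "{0..1} - F = limsup (\<lambda>n. {0..1} - H n)"
    by (auto simp: limsup_INF_SUP F_def A_def)
  ultimately have "emeasure lborel ({0..1} - F) = 0" by auto
  moreover have "f ` A m \<in> null_sets lborel" for m
  proof (rule null_setsI)
    show mA: "f ` A m \<in> sets lborel"
      using homeomorphism01_image_borel[OF hom Am] by simp
    have "emeasure lborel (f ` A m) \<le> ennreal ((1/2) ^ n)" if "n \<ge> m" for n
    proof -
      have "A m \<subseteq> H n" using that by (auto simp: A_def)
      then have "emeasure lborel (f ` A m) \<le> emeasure lborel (f ` H n)"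
        using homeomorphism01_image_borel[OF hom H(1,2)] by (intro emeasure_mono) auto
      with H(4)[of n] show ?thesis by simp
    qed
    moreover have "(\<lambda>n. ennreal ((1/2) ^ n)) \<longlonglongrightarrow> ennreal 0"
      by (intro tendsto_ennrealI LIMSEQ_realpow_zero) auto
    ultimately have "emeasure lborel (f ` A m) \<le> ennreal 0"
      by (intro LIMSEQ_le_const[where x = "ennreal 0"]) auto
    then show "emeasure lborel (f ` A m) = 0" by simp
  qed
  then have "(\<Union>m. f ` A m) \<in> null_sets lborel"
    by (rule null_sets_UN)
  then have "emeasure lborel (f ` F) = 0"
    by (simp add: F_def image_UN null_setsD1)
  ultimately show ?thesis
    unfolding singular_fun_def using Fm by blast
qed

theorem theorem3p7:
  fixes f :: "real \<Rightarrow> real"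
  assumes "f \<in> Homeo01"
  defines "P1 \<equiv> strongly_singular f"
    and "P2 \<equiv> (AE x in lborel. x \<in> {0..1} \<longrightarrow>
           ((\<lambda>r. measure lborel (f ` (cball x r \<inter> {0..1})) / measure lborel (cball x r))
              \<longlongrightarrow> 0) (at_right 0))"
    and "P3 \<equiv> (AE y in lborel.
           ((\<lambda>r. measure lborel (preimage01 f (cball y r)) / measure lborel (cball y r))
              \<longlongrightarrow> 0) (at_right 0))"
    and "P4 \<equiv> mutually_singular (pushforward01 f) lborel"
    and "P5 \<equiv> singular_fun f"
    and "P6 \<equiv> graph_length f = 2"
  shows "(P1 \<longleftrightarrow> P2) \<and> (P2 \<longleftrightarrow> P3) \<and> (P3 \<longleftrightarrow> P4) \<and> (P4 \<longleftrightarrow> P5) \<and> (P5 \<longleftrightarrow> P6)"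
proof -
  obtain g where hom: "homeomorphism {0..1} {0..1} f g"
    using assms(1) by (auto simp: Homeo01_def)
  then have hom': "homeomorphism {0..1} {0..1} g f"
    by (rule homeomorphism_symD)
  have "P1 \<longleftrightarrow> P5"
    unfolding P1_def P5_def by (rule strongly_singular_iff_singular[OF hom])
  moreover have "P1 \<longleftrightarrow> P2"
    unfolding P1_def P2_def by (rule strongly_singular_iff_image_density[OF hom])
  \<comment> \<open>The preimage condition is the density condition for \<open>g\<close>, so it
    reaches \<open>P5\<close> by passing to the inverse.\<close>
  moreover have "P3 \<longleftrightarrow> singular_fun g"
    unfolding P3_def strongly_singular_inverse_iff_preimage_density[OF hom, symmetric]
    by (rule strongly_singular_iff_singular[OF hom'])
  moreover have "singular_fun g \<longleftrightarrow> P5"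
    unfolding P5_def using singular_fun_inverse[OF hom] singular_fun_inverse[OF hom'] by blast
  moreover have "P4 \<longleftrightarrow> P5"
    unfolding P4_def P5_def by (rule singular_fun_iff_mutually_singular[OF hom])
  moreover have "P5 \<longleftrightarrow> P6"
    unfolding P5_def P6_def
    using graph_length_if_singular[OF hom] singular_if_graph_length[OF hom] by blast
  ultimately show ?thesis by blast
qed

end
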